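(* Let $s_1,s_2\in\overline{\mathbf R_\flat}$, $s=(s_2,s_1)$, $d_j,n_j\in\mathbf N$, $\tau_j\in S_{d_j+n_j}$ for $j=1,2$, $W_1=\mathbf C^{d_2}\times\mathbf C^{d_1}$, $W_2=\mathbf C^{d_2+n_2}\times\mathbf C^{d_1+n_1}$, and let $\operatorname{Tr}_{\tau,d}:\widehat{\mathcal A}_0'(W_2)\to\widehat{\mathcal A}_0'(W_1)$ be the twisted trace map $$(\operatorname{Tr}_{\tau,d}K)(z_2,z_1)=K(\iota_{\tau_2,d_2}(z_2),\iota_{\tau_1,d_1}(z_1)),\qquad z_j\in\mathbf C^{d_j}.$$ Then $\operatorname{Tr}_{\tau,d}$ restricts to continuous mappings from $$\widehat{\mathcal A}_s(W_2),\quad\widehat{\mathcal A}_s^\star(W_2),\quad\widehat{\mathcal B}_s(W_2),\quad\widehat{\mathcal B}_s^\star(W_2),\quad\widehat{\mathcal C}_s(W_2)\quad\text{and}\quad\widehat{\mathcal C}_s^\star(W_2)$$ to $$\widehat{\mathcal A}_s(W_1),\quad\widehat{\mathcal A}_s^\star(W_1),\quad\widehat{\mathcal B}_s(W_1),\quad\widehat{\mathcal B}_s^\star(W_1),\quad\widehat{\mathcal C}_s(W_1)\quad\text{and}\quad\widehat{\mathcal C}_s^\star(W_1),$$ respectively. If instead $s_1,s_2\in\mathbf R_{\flat,\infty}$, then the same holds true with $\widehat{\mathcal A}_{0,s}$, $\widehat{\mathcal B}_{0,s}$ and $\widehat{\mathcal C}_{0,s}$ in place of $\widehat{\mathcal A}_s$,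 $\widehat{\mathcal B}_s$ and $\widehat{\mathcal C}_s$, respectively, at each occurrence (and likewise for the $\star$-versions).
   Context: **Trace maps.** $S_m$ is the permutation group of $\{1,\dots,m\}$, $\{e_{j,m}\}_{j=1}^m$ the canonical basis of $\mathbf C^m$. For $\tau\in S_{d+n}$, $\iota_{\tau,d}:\mathbf C^d\to\mathbf C^{d+n}$ is the linear map with $\iota_{\tau,d}e_{j,d}=e_{\tau(j),d+n}$, $j=1,\dots,d$. On formal series the trace map acts on coefficients by $c(\operatorname{Tr}_{\tau,d}K;\alpha_2,\alpha_1)=c(K;\iota^*_{\tau_2,d_2}(\alpha_2),\iota^*_{\tau_1,d_1}(\alpha_1))$, where for $\alpha\in\mathbf N^d$, $\iota^*_{\tau,d}(\alpha)\in\mathbf N^{d+n}$ has $j$-th entry $\alpha_{\tau^{-1}(j)}$ if $\tau^{-1}(j)\le d$ and $0$ otherwise. **Indices and weights.** $\mathbf N=\{0,1,2,\dots\}$. $\overline{\mathbf R_\flat}=[0,\infty)\cup\{\flat_\sigma:\sigma>0\}$, $\mathbf R_{\flat,\infty}=(0,\infty]\cup\{\flat_\sigma:\sigma>0\}$, where the $\flat_\sigma$ are formal symbols, ordered so that $x_1<\flat_{\sigma_1}<\flat_{\sigma_2}<x_2$ whenever $x_1<\frac12\le x_2$ and $\sigma_1<\sigma_2$. For $r>0$ and a multi-index $\alpha$: $\vartheta_{r,s}(\alpha)=e^{r|\alpha|^{1/(2s)}}$ if $s\in(0,\infty)$; $\vartheta_{r,s}(\alpha)=r^{|\alpha|}(\alpha!)^{1/(2\sigma)}$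 if $s=\flat_\sigma$; $\vartheta_{r,\infty}(\alpha)=(1+|\alpha|^2)^{r/2}$; $\vartheta_{r,0}(\alpha)=1$ if $|\alpha|\le r$ and $=\infty$ if $|\alpha|>r$. Conventions: $a/\infty=0$ for all $a\in(0,\infty]$, $\infty\cdot0=0$. For $\omega:\Lambda\to[0,\infty]$, $\ell_{[\omega]}(\Lambda)$ is the set of $c:\Lambda\to\mathbf C$ with $\|c\,\omega\|_{\ell^p(\Lambda)}<\infty$, with this (quasi-/semi-)norm, $p\in(0,\infty]$ fixed (the limit spaces below do not depend on $p$). **Spaces.** For $W=\mathbf C^{m_2}\times\mathbf C^{m_1}$ and $\alpha=(\alpha_2,\alpha_1)\in\Lambda=\mathbf N^{m_2}\times\mathbf N^{m_1}$ put $\vartheta_r(\alpha)=\vartheta_{r,s_2}(\alpha_2)\vartheta_{r,s_1}(\alpha_1)$, $\omega_{r_2,r_1}(\alpha)=\vartheta_{r_2,s_2}(\alpha_2)/\vartheta_{r_1,s_1}(\alpha_1)$, $\omega^\star_{r_2,r_1}(\alpha)=\vartheta_{r_1,s_1}(\alpha_1)/\vartheta_{r_2,s_2}(\alpha_2)$. With limits over positive parameters: $\ell_{\mathcal A,s}=\operatorname{ind\,lim}_r\ell_{[\vartheta_r]}$, $\ell_{\mathcal A,s}^\star=\operatorname{proj\,lim}_r\ell_{[1/\vartheta_r]}$, $\ell_{\mathcal A,0,s}=\operatorname{proj\,lim}_r\ell_{[\vartheta_r]}$, $\ell_{\mathcal A,0,s}^\star=\operatorname{ind\,lim}_r\ell_{[1/\vartheta_r]}$;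 $\ell_{\mathcal B,s}=\operatorname{proj\,lim}_{r_1}\operatorname{ind\,lim}_{r_2}\ell_{[\omega_{r_2,r_1}]}$, $\ell_{\mathcal B,0,s}=\operatorname{proj\,lim}_{r_2}\operatorname{ind\,lim}_{r_1}\ell_{[\omega_{r_2,r_1}]}$, $\ell_{\mathcal B,s}^\star=\operatorname{proj\,lim}_{r_2}\operatorname{ind\,lim}_{r_1}\ell_{[\omega^\star_{r_2,r_1}]}$, $\ell_{\mathcal B,0,s}^\star=\operatorname{proj\,lim}_{r_1}\operatorname{ind\,lim}_{r_2}\ell_{[\omega^\star_{r_2,r_1}]}$; $\ell_{\mathcal C,s}=\operatorname{ind\,lim}_{r_2}\operatorname{proj\,lim}_{r_1}\ell_{[\omega_{r_2,r_1}]}$, $\ell_{\mathcal C,0,s}=\operatorname{ind\,lim}_{r_1}\operatorname{proj\,lim}_{r_2}\ell_{[\omega_{r_2,r_1}]}$, $\ell_{\mathcal C,s}^\star=\operatorname{ind\,lim}_{r_1}\operatorname{proj\,lim}_{r_2}\ell_{[\omega^\star_{r_2,r_1}]}$, $\ell_{\mathcal C,0,s}^\star=\operatorname{ind\,lim}_{r_2}\operatorname{proj\,lim}_{r_1}\ell_{[\omega^\star_{r_2,r_1}]}$. As sets, projective/inductive limits are intersections/unions. With $e_\alpha(z)=z^\alpha/\sqrt{\alpha!}$, the spaces $\widehat{\mathcal A}_s(W),\widehat{\mathcal A}_s^\star(W),\widehat{\mathcal B}_s(W)$, etc. consist of the formal series $K(z_2,z_1)=\sum c(K;\alpha_2,\alpha_1)e_{\alpha_2}(z_2)e_{\alpha_1}(\overline{z_1})$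 with coefficients in the sequence space with the same decorations, with transported topology. $\widehat{\mathcal A}_0'(W)$ is the space of all such formal series. *)

theory Defs
  imports
    "HOL-Analysis.Analysis"
    "HOL-Library.Function_Algebras"
    "HOL-Combinatorics.Permutations"
begin

section \<open>Multi-indices, points of complex coordinate space, formal series\<close>

text \<open>
  Dimensions vary with the arguments of the trace map and may be zero, so they are natural numbers
  and not types. Coordinates are numbered from 1, and an \<open>m\<close>-tuple is a function on \<^typ>\<open>nat\<close>
  that vanishes off \<open>{1..m}\<close>.
\<close>

type_synonym mindex = "nat \<Rightarrow> nat"

definition mindices :: "nat \<Rightarrow> mindex set" where
  "mindices m = {\<alpha>. \<forall>j. j \<notin> {1..m} \<longrightarrow> \<alpha> j = 0}"

definition mlen :: "nat \<Rightarrow> mindex \<Rightarrow> nat" where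
  "mlen m \<alpha> = (\<Sum>j\<in>{1..m}. \<alpha> j)"

definition mfact :: "nat \<Rightarrow> mindex \<Rightarrow> real" where
  "mfact m \<alpha> = (\<Prod>j\<in>{1..m}. fact (\<alpha> j))"

definition cspace :: "nat \<Rightarrow> (nat \<Rightarrow> complex) set" where
  "cspace m = {z. \<forall>j. j \<notin> {1..m} \<longrightarrow> z j = 0}"

text \<open>
  A formal series \<open>K(z\<^sub>2,z\<^sub>1) = \<Sum> c(K;\<alpha>\<^sub>2,\<alpha>\<^sub>1) e\<^bsub>\<alpha>\<^sub>2\<^esub>(z\<^sub>2) e\<^bsub>\<alpha>\<^sub>1\<^esub>(cnj z\<^sub>1)\<close> on
  \<open>W = \<complex>\<^bsup>m\<^sub>2\<^esup> \<times> \<complex>\<^bsup>m\<^sub>1\<^esup>\<close> is its family of coefficients \<open>(\<alpha>\<^sub>2,\<alpha>\<^sub>1) \<mapsto> c(K;\<alpha>\<^sub>2,\<alpha>\<^sub>1)\<close>, extended by zero.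
  Hence a space of series and the space of its coefficients are the same set with the same topology.
\<close>

type_synonym series = "mindex \<times> mindex \<Rightarrow> complex"

definition pair_indices :: "nat \<Rightarrow> nat \<Rightarrow> (mindex \<times> mindex) set" where
  "pair_indices m2 m1 = mindices m2 \<times> mindices m1"

definition formal_series :: "nat \<Rightarrow> nat \<Rightarrow> series set" where
  "formal_series m2 m1 = {K. \<forall>\<alpha>. \<alpha> \<notin> pair_indices m2 m1 \<longrightarrow> K \<alpha> = 0}"

definition mono_fn :: "nat \<Rightarrow> mindex \<Rightarrow> (nat \<Rightarrow> complex) \<Rightarrow> complex" where
  "mono_fn m \<alpha> z = (\<Prod>j\<in>{1..m}. z j ^ \<alpha> j) / complex_of_real (sqrt (mfact m \<alpha>))"

definition series_value ::
    "nat \<Rightarrow> nat \<Rightarrow> series \<Rightarrow> (nat \<Rightarrow> complex) \<Rightarrow> (nat \<Rightarrow> complex) \<Rightarrow> complex" where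
  "series_value m2 m1 K z2 z1 =
     (\<Sum>\<^sub>\<infinity>\<alpha>\<in>pair_indices m2 m1.
        K \<alpha> * mono_fn m2 (fst \<alpha>) z2 * mono_fn m1 (snd \<alpha>) (\<lambda>j. cnj (z1 j)))"

section \<open>The twisted trace map\<close>

definition unit_vec :: "nat \<Rightarrow> nat \<Rightarrow> complex" where
  "unit_vec j = (\<lambda>k. if k = j then 1 else 0)"

definition iota :: "(nat \<Rightarrow> nat) \<Rightarrow> nat \<Rightarrow> (nat \<Rightarrow> complex) \<Rightarrow> (nat \<Rightarrow> complex)" where
  "iota \<tau> d z = (\<lambda>k. \<Sum>j\<in>{1..d}. z j * unit_vec (\<tau> j) k)"

definition iota_star :: "(nat \<Rightarrow> nat) \<Rightarrow> nat \<Rightarrow> mindex \<Rightarrow> mindex" where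
  "iota_star \<tau> d \<alpha> = (\<lambda>j. if inv \<tau> j \<in> {1..d} then \<alpha> (inv \<tau> j) else 0)"

definition trace_map ::
    "(nat \<Rightarrow> nat) \<Rightarrow> nat \<Rightarrow> (nat \<Rightarrow> nat) \<Rightarrow> nat \<Rightarrow> series \<Rightarrow> series" where
  "trace_map \<tau>2 d2 \<tau>1 d1 K =
     (\<lambda>(\<alpha>2, \<alpha>1). if (\<alpha>2, \<alpha>1) \<in> pair_indices d2 d1
                then K (iota_star \<tau>2 d2 \<alpha>2, iota_star \<tau>1 d1 \<alpha>1) else 0)"

lemma iota_unit_vec:
  assumes "j \<in> {1..d}"
  shows "iota \<tau> d (unit_vec j) = unit_vec (\<tau> j)"
proof
  fix k
  have "iota \<tau> d (unit_vec j) k = (\<Sum>i\<in>{1..d}. if i = j then unit_vec (\<tau> j) k else 0)"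
    unfolding iota_def by (rule sum.cong) (auto simp: unit_vec_def)
  then show "iota \<tau> d (unit_vec j) k = unit_vec (\<tau> j) k"
    using assms by (simp del: atLeastAtMost_iff)
qed

lemma iota_apply:
  assumes "\<tau> permutes {1..d+n}"
  shows "iota \<tau> d z k = (if inv \<tau> k \<in> {1..d} then z (inv \<tau> k) else 0)"
proof -
  have eq: "k = \<tau> j \<longleftrightarrow> inv \<tau> k = j" for j
    using permutes_inv_eq[OF assms] by metis
  have "iota \<tau> d z k = (\<Sum>j\<in>{1..d}. if inv \<tau> k = j then z j else 0)"
    unfolding iota_def unit_vec_def by (rule sum.cong) (auto simp: eq)
  then show ?thesis by (simp del: atLeastAtMost_iff)
qed

lemma iota_in_cspace:
  assumes "\<tau> permutes {1..d+n}"
  shows "iota \<tau> d z \<in> cspace (d+n)"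
proof -
  have "iota \<tau> d z k = 0" if "k \<notin> {1..d+n}" for k
  proof -
    have "inv \<tau> k = k" using permutes_not_in[OF permutes_inv[OF assms] that] .
    then show ?thesis using that by (auto simp: iota_apply[OF assms])
  qed
  then show ?thesis by (auto simp: cspace_def)
qed

lemma iota_star_in_mindices:
  assumes "\<tau> permutes {1..d+n}"
  shows "iota_star \<tau> d \<alpha> \<in> mindices (d+n)"
proof -
  have "iota_star \<tau> d \<alpha> k = 0" if "k \<notin> {1..d+n}" for k
  proof -
    have "inv \<tau> k = k" using permutes_not_in[OF permutes_inv[OF assms] that] .
    then show ?thesis using that by (auto simp: iota_star_def)
  qed
  then show ?thesis by (auto simp: mindices_def)
qed

lemma trace_map_formal_series: "trace_map \<tau>2 d2 \<tau>1 d1 K \<in> formal_series d2 d1"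
  by (auto simp: trace_map_def formal_series_def split: prod.splits)

lemma iota_star_permuted:
  assumes "\<tau> permutes {1..d+n}" "\<alpha> \<in> mindices d"
  shows "iota_star \<tau> d \<alpha> (\<tau> j) = \<alpha> j"
  using assms permutes_inverses(2)[OF assms(1)] by (auto simp: iota_star_def mindices_def)

lemma prod_permuted_split:
  fixes f :: "nat \<Rightarrow> 'a::comm_monoid_mult"
  assumes \<tau>: "\<tau> permutes {1..d+n}" and one: "\<And>j. j \<in> {d+1..d+n} \<Longrightarrow> f (\<tau> j) = 1"
  shows "(\<Prod>j\<in>{1..d+n}. f j) = (\<Prod>j\<in>{1..d}. f (\<tau> j))"
proof -
  have "(\<Prod>j\<in>{1..d+n}. f j) = (\<Prod>j\<in>{1..d+n}. f (\<tau> j))"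
    using prod.permute[OF \<tau>, of f] by (simp add: o_def)
  also have "\<dots> = (\<Prod>j\<in>{1..d}. f (\<tau> j))"
    by (rule prod.mono_neutral_right) (use one in auto)
  finally show ?thesis .
qed

lemma mono_fn_iota:
  assumes \<tau>: "\<tau> permutes {1..d+n}" and \<alpha>: "\<alpha> \<in> mindices d"
  shows "mono_fn (d+n) (iota_star \<tau> d \<alpha>) (iota \<tau> d z) = mono_fn d \<alpha> z"
proof -
  have i: "iota \<tau> d z (\<tau> j) = z j" if "j \<in> {1..d}" for j
    using that permutes_inverses(2)[OF \<tau>] by (simp add: iota_apply[OF \<tau>])
  have z: "\<alpha> j = 0" if "j \<in> {d+1..d+n}" for j
    using \<alpha> that by (auto simp: mindices_def)
  have a: "(\<Prod>j\<in>{1..d+n}. iota \<tau> d z j ^ iota_star \<tau> d \<alpha> j) = (\<Prod>j\<in>{1..d}. z j ^ \<alpha> j)"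
    by (subst prod_permuted_split[OF \<tau>]) (auto simp: iota_star_permuted[OF \<tau> \<alpha>] z i)
  have b: "mfact (d+n) (iota_star \<tau> d \<alpha>) = mfact d \<alpha>"
    unfolding mfact_def
    by (subst prod_permuted_split[OF \<tau>]) (auto simp: iota_star_permuted[OF \<tau> \<alpha>] z)
  show ?thesis unfolding mono_fn_def a b ..
qed

lemma mono_fn_iota_eq_0:
  assumes \<tau>: "\<tau> permutes {1..d+n}" and \<beta>: "\<beta> \<in> mindices (d+n)"
    and nin: "\<beta> \<notin> iota_star \<tau> d ` mindices d"
  shows "mono_fn (d+n) \<beta> (iota \<tau> d z) = 0"
proof -
  define \<alpha> where "\<alpha> = (\<lambda>j. if j \<in> {1..d} then \<beta> (\<tau> j) else 0)"
  have "\<alpha> \<in> mindices d" by (auto simp: \<alpha>_def mindices_def)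
  with nin have "iota_star \<tau> d \<alpha> \<noteq> \<beta>" by blast
  then obtain k where k: "iota_star \<tau> d \<alpha> k \<noteq> \<beta> k" by blast
  have "inv \<tau> k \<notin> {1..d}" "\<beta> k \<noteq> 0"
    using k permutes_inverses(1)[OF \<tau>] by (auto simp: iota_star_def \<alpha>_def split: if_splits)
  moreover from this have "k \<in> {1..d+n}" using \<beta> by (auto simp: mindices_def)
  moreover have "iota \<tau> d z k = 0" using \<open>inv \<tau> k \<notin> {1..d}\<close> by (simp add: iota_apply[OF \<tau>] del: atLeastAtMost_iff)
  ultimately have "(\<Prod>j\<in>{1..d+n}. iota \<tau> d z j ^ \<beta> j) = 0"
    by (intro prod_zero) (auto intro!: bexI[of _ k])
  then show ?thesis by (simp add: mono_fn_def)
qed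

text \<open>
  On coefficients, \<^const>\<open>trace_map\<close> is the substitution \<open>K(\<iota> z\<^sub>2, \<iota> z\<^sub>1)\<close>. The identity needs no
  convergence hypothesis, since the two sides are, up to vanishing terms, the same sum.
\<close>

theorem series_value_trace_map:
  assumes \<tau>2: "\<tau>2 permutes {1..d2+n2}" and \<tau>1: "\<tau>1 permutes {1..d1+n1}"
  shows "series_value d2 d1 (trace_map \<tau>2 d2 \<tau>1 d1 K) z2 z1
       = series_value (d2+n2) (d1+n1) K (iota \<tau>2 d2 z2) (iota \<tau>1 d1 z1)"
proof -
  define h where "h = (\<lambda>(\<alpha>2, \<alpha>1). (iota_star \<tau>2 d2 \<alpha>2, iota_star \<tau>1 d1 \<alpha>1))"
  define g where "g = (\<lambda>\<alpha>. K \<alpha> * mono_fn (d2+n2) (fst \<alpha>) (iota \<tau>2 d2 z2)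
      * mono_fn (d1+n1) (snd \<alpha>) (\<lambda>j. cnj (iota \<tau>1 d1 z1 j)))"
  have cnj: "(\<lambda>j. cnj (iota \<tau>1 d1 z1 j)) = iota \<tau>1 d1 (\<lambda>j. cnj (z1 j))"
    by (auto simp: iota_apply[OF \<tau>1])
  have inj1: "inj_on (iota_star \<tau> d) (mindices d)" if "\<tau> permutes {1..d+n}" for \<tau> d n
    by (rule inj_onI, rule ext) (metis iota_star_permuted[OF that])
  have inj: "inj_on h (pair_indices d2 d1)"
    using inj1[OF \<tau>2] inj1[OF \<tau>1] by (auto simp: inj_on_def h_def pair_indices_def)
  have "series_value d2 d1 (trace_map \<tau>2 d2 \<tau>1 d1 K) z2 z1 = infsum (g \<circ> h) (pair_indices d2 d1)"
    unfolding series_value_def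
    by (rule infsum_cong)
       (auto simp: trace_map_def g_def h_def pair_indices_def cnj mono_fn_iota[OF \<tau>2] mono_fn_iota[OF \<tau>1])
  also have "\<dots> = infsum g (h ` pair_indices d2 d1)"
    by (rule infsum_reindex[OF inj, symmetric])
  also have "\<dots> = infsum g (pair_indices (d2+n2) (d1+n1))"
  proof (rule infsum_cong_neutral)
    fix \<beta> assume \<beta>: "\<beta> \<in> pair_indices (d2+n2) (d1+n1) - h ` pair_indices d2 d1"
    then have "fst \<beta> \<notin> iota_star \<tau>2 d2 ` mindices d2 \<or> snd \<beta> \<notin> iota_star \<tau>1 d1 ` mindices d1"
      by (force simp: h_def pair_indices_def image_iff)
    then show "g \<beta> = 0"
      using \<beta> mono_fn_iota_eq_0[OF \<tau>2] mono_fn_iota_eq_0[OF \<tau>1]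
      by (auto simp: g_def cnj pair_indices_def)
  qed (use iota_star_in_mindices[OF \<tau>2] iota_star_in_mindices[OF \<tau>1] in
        \<open>auto simp: h_def pair_indices_def\<close>)
  finally show ?thesis by (simp add: series_value_def g_def)
qed

section \<open>Locally convex topologies and limits\<close>

definition cscale :: "complex \<Rightarrow> ('i \<Rightarrow> complex) \<Rightarrow> ('i \<Rightarrow> complex)" where
  "cscale a c = (\<lambda>i. a * c i)"

interpretation cfun: vector_space "cscale :: complex \<Rightarrow> ('i \<Rightarrow> complex) \<Rightarrow> ('i \<Rightarrow> complex)"
  by unfold_locales (auto simp: cscale_def algebra_simps)

definition cfun_convex :: "('i \<Rightarrow> complex) set \<Rightarrow> bool" where
  "cfun_convex W \<longleftrightarrow> (\<forall>x\<in>W. \<forall>y\<in>W. \<forall>t\<in>{0..1::real}.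
     cscale (of_real (1 - t)) x + cscale (of_real t) y \<in> W)"

text \<open>Not required to be Hausdorff: the weights below may vanish, so that the spaces are only seminormed.\<close>

definition locally_convex :: "('i \<Rightarrow> complex) topology \<Rightarrow> bool" where
  "locally_convex T \<longleftrightarrow>
     cfun.subspace (topspace T) \<and>
     continuous_map (prod_topology T T) T (\<lambda>(x, y). x + y) \<and>
     continuous_map (prod_topology euclidean T) T (\<lambda>(a, x). cscale a x) \<and>
     (\<forall>U x. openin T U \<and> x \<in> U \<longrightarrow> (\<exists>W. openin T W \<and> cfun_convex W \<and> x \<in> W \<and> W \<subseteq> U))"

text \<open>
  Limits of a family of topological spaces of functions indexed by a parameter \<open>r > 0\<close>. The projective
  limit is the intersection with the coarsest topology for which all inclusions into the \<open>X r\<close> are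
  continuous.

  The inductive limit is the union with the locally convex inductive limit topology. If the union is a
  linear space, this is the finest locally convex topology for which all inclusions of the \<open>X r\<close> are
  continuous (lemma \<open>ind_lim_finest\<close>), written as the supremum of all such topologies. For spaces
  that are not nested the union need not be linear (among the spaces below, this happens only for
  \<open>A\<^sub>s\<close> when exactly one of \<open>s\<^sub>1, s\<^sub>2\<close> is zero); the underlying set is still the union, and it
  carries the topology induced from the locally convex inductive limit on its linear span.
\<close>

definition proj_lim :: "(real \<Rightarrow> ('i \<Rightarrow> complex) topology) \<Rightarrow> ('i \<Rightarrow> complex) topology" where
  "proj_lim X =
     (let V = (\<Inter>r\<in>{0<..}. topspace (X r))
      in topology_generated_by {U \<inter> V | U r. 0 < r \<and> openin (X r) U})"

definition ind_lim :: "(real \<Rightarrow> ('i \<Rightarrow> complex) topology) \<Rightarrow> ('i \<Rightarrow> complex) topology" where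
  "ind_lim X =
     (let V = (\<Union>r\<in>{0<..}. topspace (X r))
      in topology_generated_by {U \<inter> V | U T.
           locally_convex T \<and> topspace T = cfun.span V \<and>
           (\<forall>r>0. continuous_map (X r) T (\<lambda>c. c)) \<and> openin T U})"

lemma topspace_proj_lim: "topspace (proj_lim X) = (\<Inter>r\<in>{0<..}. topspace (X r))" (is "_ = ?V")
proof -
  have "?V \<in> {U \<inter> ?V | U r. 0 < r \<and> openin (X r) U}"
    by (rule CollectI, rule exI[of _ "topspace (X 1)"], rule exI[of _ 1]) auto
  then show ?thesis unfolding proj_lim_def Let_def by auto
qed

lemma locally_convex_indiscrete:
  assumes S: "cfun.subspace S"
  shows "locally_convex (topology_generated_by {S})" (is "locally_convex ?T")
proof -
  have open_cases: "U = {} \<or> U = S" if "openin ?T U" for U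
  proof -
    from that have "generate_topology_on {S} U" by (rule openin_topology_generated_by)
    then show ?thesis by induction blast+
  qed
  have cont: "continuous_map X ?T f" if "f \<in> topspace X \<rightarrow> S" for X and f :: "'b \<Rightarrow> _"
  proof -
    have "openin X {x \<in> topspace X. f x \<in> U}" if "openin ?T U" for U
      using open_cases[OF that]
    proof
      assume "U = S"
      then have "{x \<in> topspace X. f x \<in> U} = topspace X" using \<open>f \<in> topspace X \<rightarrow> S\<close> by auto
      then show ?thesis by simp
    qed simp
    then show ?thesis using that by (auto simp: continuous_map_def)
  qed
  have "cfun_convex S"
    using S by (auto simp: cfun_convex_def intro!: cfun.subspace_add cfun.subspace_scale)
  moreover have "openin ?T S" by (rule topology_generated_by_Basis) simp
  ultimately show ?thesis
    unfolding locally_convex_def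
    using S open_cases
    by (auto intro!: cont cfun.subspace_add[OF S] cfun.subspace_scale[OF S])
qed

lemma topspace_ind_lim: "topspace (ind_lim X) = (\<Union>r\<in>{0<..}. topspace (X r))" (is "_ = ?V")
proof -
  let ?T = "topology_generated_by {cfun.span ?V}"
  have VS: "?V \<subseteq> cfun.span ?V" by (rule cfun.span_superset)
  have top: "openin ?T (cfun.span ?V)" by (rule topology_generated_by_Basis) simp
  have cont: "continuous_map (X r) ?T (\<lambda>c. c)" if "0 < r" for r
  proof (rule continuous_on_generated_topo)
    show "openin (X r) ((\<lambda>c. c) -` U \<inter> topspace (X r))" if "U \<in> {cfun.span ?V}" for U
    proof -
      have "(\<lambda>c. c) -` U \<inter> topspace (X r) = topspace (X r)" using that VS \<open>0 < r\<close> by blast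
      then show ?thesis by simp
    qed
    show "(\<lambda>c. c) ` topspace (X r) \<subseteq> \<Union>{cfun.span ?V}" using VS that by auto
  qed
  have "?V \<in> {U \<inter> ?V | U T. locally_convex T \<and> topspace T = cfun.span ?V \<and>
           (\<forall>r>0. continuous_map (X r) T (\<lambda>c. c)) \<and> openin T U}"
    using VS top cont locally_convex_indiscrete[OF cfun.subspace_span]
    by (intro CollectI exI[of _ "cfun.span ?V"] exI[of _ ?T]) auto
  then show ?thesis unfolding ind_lim_def Let_def by auto
qed

theorem ind_lim_finest:
  assumes V: "cfun.subspace (\<Union>r\<in>{0<..}. topspace (X r))" (is "cfun.subspace ?V")
  shows "locally_convex (ind_lim X)"
    and "\<And>r. 0 < r \<Longrightarrow> continuous_map (X r) (ind_lim X) (\<lambda>c. c)"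
    and "\<And>T. locally_convex T \<Longrightarrow> topspace T = ?V \<Longrightarrow>
          (\<And>r. 0 < r \<Longrightarrow> continuous_map (X r) T (\<lambda>c. c)) \<Longrightarrow> continuous_map (ind_lim X) T (\<lambda>c. c)"
proof -
  define adm where "adm = (\<lambda>T. locally_convex T \<and> topspace T = ?V \<and>
           (\<forall>r>0. continuous_map (X r) T (\<lambda>c. c)))"
  define B where "B = {U. \<exists>T. adm T \<and> openin T U}"
  have span: "cfun.span ?V = ?V" using V by (rule cfun.span_eq_iff[THEN iffD2])
  have "{U \<inter> ?V | U T. locally_convex T \<and> topspace T = cfun.span ?V \<and>
           (\<forall>r>0. continuous_map (X r) T (\<lambda>c. c)) \<and> openin T U} = B" (is "?C = B")
  proof (rule set_eqI)
    fix W
    have "U \<inter> ?V = U" if "openin T U" "topspace T = ?V" for T U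
      using openin_subset[OF that(1)] that(2) by (simp add: Int_absorb2)
    then show "W \<in> ?C \<longleftrightarrow> W \<in> B"
      unfolding B_def adm_def span mem_Collect_eq by metis
  qed
  then have G: "ind_lim X = topology_generated_by B" unfolding ind_lim_def Let_def by simp
  have UB: "\<Union>B = ?V"
    using topspace_ind_lim[of X] unfolding G by simp
  have topG: "topspace (ind_lim X) = ?V" by (rule topspace_ind_lim)
  have GT: "continuous_map (ind_lim X) T (\<lambda>c. c)" if "adm T" for T
  proof -
    have eq: "{x \<in> ?V. x \<in> U} = U" if "openin T U" for U
      using openin_subset[OF that] \<open>adm T\<close> by (auto simp: adm_def)
    have "openin (ind_lim X) {x \<in> topspace (ind_lim X). x \<in> U}" if "openin T U" for U
    proof -
      have "U \<in> B" using that \<open>adm T\<close> by (auto simp: B_def)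
      then have "openin (ind_lim X) U" unfolding G by (rule topology_generated_by_Basis)
      then show ?thesis unfolding topG eq[OF that] .
    qed
    then show ?thesis using that topG by (auto simp: continuous_map_def adm_def)
  qed
  have into: "continuous_map Y (ind_lim X) f"
    if "f ` topspace Y \<subseteq> ?V" "\<And>T. adm T \<Longrightarrow> continuous_map Y T f" for Y and f :: "'b \<Rightarrow> _"
    unfolding G
  proof (rule continuous_on_generated_topo)
    fix U assume "U \<in> B"
    then obtain T where T: "adm T" "openin T U" by (auto simp: B_def)
    have "openin Y {x \<in> topspace Y. f x \<in> U}"
      using that(2)[OF T(1)] T(2) by (rule openin_continuous_map_preimage)
    moreover have "f -` U \<inter> topspace Y = {x \<in> topspace Y. f x \<in> U}" by auto
    ultimately show "openin Y (f -` U \<inter> topspace Y)" by simp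
  qed (use that UB in simp)
  have add: "continuous_map (prod_topology (ind_lim X) (ind_lim X)) (ind_lim X) (\<lambda>(x, y). x + y)"
  proof (rule into)
    show "(\<lambda>(x, y). x + y) ` topspace (prod_topology (ind_lim X) (ind_lim X)) \<subseteq> ?V"
      unfolding topspace_prod_topology topG using cfun.subspace_add[OF V] by auto
    fix T assume T: "adm T"
    have "continuous_map (prod_topology (ind_lim X) (ind_lim X)) (prod_topology T T) (\<lambda>(x, y). (x, y))"
      using GT[OF T] continuous_map_prod_top[of "ind_lim X" "ind_lim X" T T "\<lambda>c. c" "\<lambda>c. c"]
      by simp
    moreover have "continuous_map (prod_topology T T) T (\<lambda>(x, y). x + y)"
      using T by (simp add: adm_def locally_convex_def)
    ultimately show "continuous_map (prod_topology (ind_lim X) (ind_lim X)) T (\<lambda>(x, y). x + y)"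
      using continuous_map_compose by (fastforce simp: o_def case_prod_beta)
  qed
  have scale: "continuous_map (prod_topology euclidean (ind_lim X)) (ind_lim X) (\<lambda>(a, x). cscale a x)"
  proof (rule into)
    show "(\<lambda>(a, x). cscale a x) ` topspace (prod_topology euclidean (ind_lim X)) \<subseteq> ?V"
      unfolding topspace_prod_topology topG using cfun.subspace_scale[OF V] by auto
    fix T assume T: "adm T"
    have "continuous_map (prod_topology euclidean (ind_lim X)) (prod_topology euclidean T)
            (\<lambda>(a :: complex, x). (a, x))"
      using GT[OF T] continuous_map_prod_top[of euclidean "ind_lim X" euclidean T "\<lambda>a. a" "\<lambda>c. c"]
      by simp
    moreover have "continuous_map (prod_topology euclidean T) T (\<lambda>(a, x). cscale a x)"
      using T by (simp add: adm_def locally_convex_def)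
    ultimately show "continuous_map (prod_topology euclidean (ind_lim X)) T (\<lambda>(a, x). cscale a x)"
      using continuous_map_compose by (fastforce simp: o_def case_prod_beta)
  qed
  have base: "\<exists>W. openin (ind_lim X) W \<and> cfun_convex W \<and> x \<in> W \<and> W \<subseteq> U"
    if "openin (ind_lim X) U" "x \<in> U" for U x
  proof -
    from that(1) have "generate_topology_on B U"
      unfolding G by (rule openin_topology_generated_by)
    then show ?thesis using that(2)
    proof (induction arbitrary: x)
      case (Int U1 U2)
      then obtain W1 W2 where
        "openin (ind_lim X) W1" "cfun_convex W1" "x \<in> W1" "W1 \<subseteq> U1"
        "openin (ind_lim X) W2" "cfun_convex W2" "x \<in> W2" "W2 \<subseteq> U2" by (meson IntE)
      then show ?case
        by (intro exI[of _ "W1 \<inter> W2"]) (auto simp: cfun_convex_def)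
    next
      case (UN K)
      then show ?case by (meson Union_iff Union_upper subset_trans)
    next
      case (Basis U)
      then obtain T where T: "adm T" "openin T U" by (auto simp: B_def)
      then obtain W where W: "openin T W" "cfun_convex W" "x \<in> W" "W \<subseteq> U"
        using Basis.prems unfolding adm_def locally_convex_def by meson
      have "W \<in> B" using W(1) T(1) by (auto simp: B_def)
      then have "openin (ind_lim X) W" unfolding G by (rule topology_generated_by_Basis)
      with W show ?case by blast
    qed simp
  qed
  show "locally_convex (ind_lim X)"
    unfolding locally_convex_def using V topG add scale base by simp
  show "continuous_map (X r) (ind_lim X) (\<lambda>c. c)" if "0 < r" for r
    using that by (intro into) (auto simp: adm_def)
  show "continuous_map (ind_lim X) T (\<lambda>c. c)"
    if "locally_convex T" "topspace T = ?V" "\<And>r. 0 < r \<Longrightarrow> continuous_map (X r) T (\<lambda>c. c)" for T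
    using that by (intro GT) (simp add: adm_def)
qed

section \<open>Weights\<close>

text \<open>\<open>Num x\<close> is the real number \<open>x\<close>, and \<open>Flat \<sigma>\<close> the symbol \<open>\<flat>\<^sub>\<sigma>\<close>.\<close>

datatype windex = Num real | Flat real | Infty

definition R_flat_closed :: "windex set" where
  "R_flat_closed = {Num x | x. 0 \<le> x} \<union> {Flat \<sigma> | \<sigma>. 0 < \<sigma>}"

definition R_flat_infty :: "windex set" where
  "R_flat_infty = {Num x | x. 0 < x} \<union> {Infty} \<union> {Flat \<sigma> | \<sigma>. 0 < \<sigma>}"

fun theta :: "nat \<Rightarrow> windex \<Rightarrow> real \<Rightarrow> mindex \<Rightarrow> ennreal" where
  "theta m (Num x) r \<alpha> =
     (if x = 0 then (if real (mlen m \<alpha>) \<le> r then 1 else \<infinity>)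
      else ennreal (exp (r * real (mlen m \<alpha>) powr (1 / (2 * x)))))"
| "theta m (Flat \<sigma>) r \<alpha> = ennreal (r ^ mlen m \<alpha> * mfact m \<alpha> powr (1 / (2 * \<sigma>)))"
| "theta m Infty r \<alpha> = ennreal ((1 + (real (mlen m \<alpha>))\<^sup>2) powr (r / 2))"

text \<open>
  Arithmetic in \<^typ>\<open>ennreal\<close> obeys the required conventions \<open>a / \<infinity> = 0\<close> (also for \<open>a = \<infinity>\<close>)
  and \<open>\<infinity> \<cdot> 0 = 0\<close>.
\<close>

definition vartheta :: "nat \<Rightarrow> nat \<Rightarrow> windex \<Rightarrow> windex \<Rightarrow> real \<Rightarrow> mindex \<times> mindex \<Rightarrow> ennreal" where
  "vartheta m2 m1 s2 s1 r = (\<lambda>(\<alpha>2, \<alpha>1). theta m2 s2 r \<alpha>2 * theta m1 s1 r \<alpha>1)"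

definition omega ::
    "nat \<Rightarrow> nat \<Rightarrow> windex \<Rightarrow> windex \<Rightarrow> real \<Rightarrow> real \<Rightarrow> mindex \<times> mindex \<Rightarrow> ennreal" where
  "omega m2 m1 s2 s1 r2 r1 = (\<lambda>(\<alpha>2, \<alpha>1). theta m2 s2 r2 \<alpha>2 / theta m1 s1 r1 \<alpha>1)"

definition omega_star ::
    "nat \<Rightarrow> nat \<Rightarrow> windex \<Rightarrow> windex \<Rightarrow> real \<Rightarrow> real \<Rightarrow> mindex \<times> mindex \<Rightarrow> ennreal" where
  "omega_star m2 m1 s2 s1 r2 r1 = (\<lambda>(\<alpha>2, \<alpha>1). theta m1 s1 r1 \<alpha>1 / theta m2 s2 r2 \<alpha>2)"

section \<open>Weighted sequence spaces\<close>

definition ennreal_powr :: "ennreal \<Rightarrow> real \<Rightarrow> ennreal" where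
  "ennreal_powr x a = (if x = \<infinity> then \<infinity> else ennreal (enn2real x powr a))"

definition lp_norm :: "ennreal \<Rightarrow> 'i set \<Rightarrow> ('i \<Rightarrow> ennreal) \<Rightarrow> ennreal" where
  "lp_norm p \<Lambda> f =
     (if p = \<infinity> then (SUP i\<in>\<Lambda>. f i)
      else ennreal_powr (\<integral>\<^sup>+ i. ennreal_powr (f i) (enn2real p) \<partial>count_space \<Lambda>) (1 / enn2real p))"

definition wnorm :: "ennreal \<Rightarrow> 'i set \<Rightarrow> ('i \<Rightarrow> ennreal) \<Rightarrow> ('i \<Rightarrow> complex) \<Rightarrow> ennreal" where
  "wnorm p \<Lambda> \<omega> c = lp_norm p \<Lambda> (\<lambda>i. ennreal (norm (c i)) * \<omega> i)"

definition wspace :: "ennreal \<Rightarrow> 'i set \<Rightarrow> ('i \<Rightarrow> ennreal) \<Rightarrow> ('i \<Rightarrow> complex) set" where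
  "wspace p \<Lambda> \<omega> = {c. (\<forall>i. i \<notin> \<Lambda> \<longrightarrow> c i = 0) \<and> wnorm p \<Lambda> \<omega> c < \<infinity>}"

text \<open>
  The topology of the quasi-seminorm: a set is open if it contains a ball around each of its points.
\<close>

definition wopen ::
    "ennreal \<Rightarrow> 'i set \<Rightarrow> ('i \<Rightarrow> ennreal) \<Rightarrow> ('i \<Rightarrow> complex) set \<Rightarrow> bool" where
  "wopen p \<Lambda> \<omega> U \<longleftrightarrow> U \<subseteq> wspace p \<Lambda> \<omega> \<and>
     (\<forall>c\<in>U. \<exists>\<epsilon>>0::real. {c' \<in> wspace p \<Lambda> \<omega>. wnorm p \<Lambda> \<omega> (c' - c) < ennreal \<epsilon>} \<subseteq> U)"

definition wlp :: "ennreal \<Rightarrow> 'i set \<Rightarrow> ('i \<Rightarrow> ennreal) \<Rightarrow> ('i \<Rightarrow> complex) topology" where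
  "wlp p \<Lambda> \<omega> = topology (wopen p \<Lambda> \<omega>)"

lemma istopology_wopen: "istopology (wopen p \<Lambda> \<omega>)"
  unfolding istopology_def
proof (intro conjI allI impI)
  fix S T assume S: "wopen p \<Lambda> \<omega> S" and T: "wopen p \<Lambda> \<omega> T"
  have "\<exists>\<epsilon>>0::real. {c' \<in> wspace p \<Lambda> \<omega>. wnorm p \<Lambda> \<omega> (c' - c) < ennreal \<epsilon>} \<subseteq> S \<inter> T"
    if "c \<in> S \<inter> T" for c
  proof -
    obtain e1 :: real where e1: "e1 > 0"
      "{c' \<in> wspace p \<Lambda> \<omega>. wnorm p \<Lambda> \<omega> (c' - c) < ennreal e1} \<subseteq> S"
      using S \<open>c \<in> S \<inter> T\<close> unfolding wopen_def by blast
    obtain e2 :: real where e2: "e2 > 0"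
      "{c' \<in> wspace p \<Lambda> \<omega>. wnorm p \<Lambda> \<omega> (c' - c) < ennreal e2} \<subseteq> T"
      using T \<open>c \<in> S \<inter> T\<close> unfolding wopen_def by blast
    have "ennreal (min e1 e2) \<le> ennreal e1" "ennreal (min e1 e2) \<le> ennreal e2"
      by (simp_all add: ennreal_leI)
    then have "{c' \<in> wspace p \<Lambda> \<omega>. wnorm p \<Lambda> \<omega> (c' - c) < ennreal (min e1 e2)} \<subseteq> S \<inter> T"
      using e1(2) e2(2) by (auto dest: order.strict_trans2)
    then show ?thesis using e1(1) e2(1) by (intro exI[of _ "min e1 e2"]) auto
  qed
  then show "wopen p \<Lambda> \<omega> (S \<inter> T)" using S unfolding wopen_def by blast
next
  fix \<K> assume K: "\<forall>S\<in>\<K>. wopen p \<Lambda> \<omega> S"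
  have "\<exists>\<epsilon>>0::real. {c' \<in> wspace p \<Lambda> \<omega>. wnorm p \<Lambda> \<omega> (c' - c) < ennreal \<epsilon>} \<subseteq> \<Union>\<K>"
    if "c \<in> \<Union>\<K>" for c
  proof -
    from that obtain S where S: "S \<in> \<K>" "c \<in> S" by blast
    then obtain \<epsilon> :: real where "\<epsilon> > 0"
      "{c' \<in> wspace p \<Lambda> \<omega>. wnorm p \<Lambda> \<omega> (c' - c) < ennreal \<epsilon>} \<subseteq> S"
      using K unfolding wopen_def by blast
    then show ?thesis using S(1) by blast
  qed
  moreover have "\<Union>\<K> \<subseteq> wspace p \<Lambda> \<omega>" using K unfolding wopen_def by blast
  ultimately show "wopen p \<Lambda> \<omega> (\<Union>\<K>)" unfolding wopen_def by blast
qed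

lemma openin_wlp: "openin (wlp p \<Lambda> \<omega>) U \<longleftrightarrow> wopen p \<Lambda> \<omega> U"
  by (simp add: wlp_def istopology_wopen)

lemma topspace_wlp: "topspace (wlp p \<Lambda> \<omega>) = wspace p \<Lambda> \<omega>"
proof
  show "topspace (wlp p \<Lambda> \<omega>) \<subseteq> wspace p \<Lambda> \<omega>"
    using openin_wlp[of p \<Lambda> \<omega> "topspace (wlp p \<Lambda> \<omega>)"] openin_topspace[of "wlp p \<Lambda> \<omega>"]
    unfolding wopen_def by blast
  have "wopen p \<Lambda> \<omega> (wspace p \<Lambda> \<omega>)"
    unfolding wopen_def by (auto intro: exI[of _ 1])
  then show "wspace p \<Lambda> \<omega> \<subseteq> topspace (wlp p \<Lambda> \<omega>)"
    by (simp add: openin_subset flip: openin_wlp)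
qed

section \<open>The spaces of formal series\<close>

definition A_hat where
  "A_hat p s2 s1 m2 m1 =
     ind_lim (\<lambda>r. wlp p (pair_indices m2 m1) (vartheta m2 m1 s2 s1 r))"

definition A_hat_star where
  "A_hat_star p s2 s1 m2 m1 =
     proj_lim (\<lambda>r. wlp p (pair_indices m2 m1) (\<lambda>\<alpha>. 1 / vartheta m2 m1 s2 s1 r \<alpha>))"

definition A0_hat where
  "A0_hat p s2 s1 m2 m1 =
     proj_lim (\<lambda>r. wlp p (pair_indices m2 m1) (vartheta m2 m1 s2 s1 r))"

definition A0_hat_star where
  "A0_hat_star p s2 s1 m2 m1 =
     ind_lim (\<lambda>r. wlp p (pair_indices m2 m1) (\<lambda>\<alpha>. 1 / vartheta m2 m1 s2 s1 r \<alpha>))"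

definition B_hat where
  "B_hat p s2 s1 m2 m1 =
     proj_lim (\<lambda>r1. ind_lim (\<lambda>r2. wlp p (pair_indices m2 m1) (omega m2 m1 s2 s1 r2 r1)))"

definition B0_hat where
  "B0_hat p s2 s1 m2 m1 =
     proj_lim (\<lambda>r2. ind_lim (\<lambda>r1. wlp p (pair_indices m2 m1) (omega m2 m1 s2 s1 r2 r1)))"

definition B_hat_star where
  "B_hat_star p s2 s1 m2 m1 =
     proj_lim (\<lambda>r2. ind_lim (\<lambda>r1. wlp p (pair_indices m2 m1) (omega_star m2 m1 s2 s1 r2 r1)))"

definition B0_hat_star where
  "B0_hat_star p s2 s1 m2 m1 =
     proj_lim (\<lambda>r1. ind_lim (\<lambda>r2. wlp p (pair_indices m2 m1) (omega_star m2 m1 s2 s1 r2 r1)))"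

definition C_hat where
  "C_hat p s2 s1 m2 m1 =
     ind_lim (\<lambda>r2. proj_lim (\<lambda>r1. wlp p (pair_indices m2 m1) (omega m2 m1 s2 s1 r2 r1)))"

definition C0_hat where
  "C0_hat p s2 s1 m2 m1 =
     ind_lim (\<lambda>r1. proj_lim (\<lambda>r2. wlp p (pair_indices m2 m1) (omega m2 m1 s2 s1 r2 r1)))"

definition C_hat_star where
  "C_hat_star p s2 s1 m2 m1 =
     ind_lim (\<lambda>r1. proj_lim (\<lambda>r2. wlp p (pair_indices m2 m1) (omega_star m2 m1 s2 s1 r2 r1)))"

definition C0_hat_star where
  "C0_hat_star p s2 s1 m2 m1 =
     ind_lim (\<lambda>r2. proj_lim (\<lambda>r1. wlp p (pair_indices m2 m1) (omega_star m2 m1 s2 s1 r2 r1)))"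

end

(* The weights depend on a multi-index only through its length and its factorial, both of which are
   unchanged by padding with zeros and permuting. So on coefficients the trace map is a reindexing
   that does not increase any of the weighted norms, and it is linear, hence compatible with
   projective and inductive limits taken over the same parameters. *)

theory Submission
  imports Defs
begin

section \<open>Functoriality of the limits\<close>

text \<open>Each generator of \<open>proj_lim Y\<close> comes from an open set of a single
  \<open>Y r\<close>, so its preimage comes from an open set of \<open>X r\<close> for the same r.
  The \<open>X r\<close> and \<open>Y r\<close> may themselves be inductive limits, as in the B
  spaces.\<close>

lemma continuous_map_proj_lim:
  assumes f: "\<And>r. 0 < r \<Longrightarrow> continuous_map (X r) (Y r) f"
  shows "continuous_map (proj_lim X) (proj_lim Y) f"
proof -
  let ?V = "\<Inter>r\<in>{0<..}. topspace (X r)" and ?W = "\<Inter>r\<in>{0<..}. topspace (Y r)"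
  have VW: "f x \<in> ?W" if "x \<in> ?V" for x
    using that f by (auto simp: continuous_map_def Pi_iff)
  define B where "B = {U \<inter> ?W | U r. 0 < r \<and> openin (Y r) U}"
  have G: "proj_lim Y = topology_generated_by B"
    unfolding proj_lim_def Let_def B_def ..
  have UB: "\<Union>B = ?W"
    using topspace_proj_lim[of Y] unfolding G by simp
  show ?thesis
    unfolding G
  proof (rule continuous_on_generated_topo)
    fix U' assume "U' \<in> B"
    then obtain U r where U: "U' = U \<inter> ?W" "0 < r" "openin (Y r) U"
      unfolding B_def by blast
    \<comment> \<open>The cut with \<open>?W\<close> disappears: by \<open>VW\<close>, every point
      of \<open>?V\<close> is sent into \<open>?W\<close>.\<close>
    have "f -` U' \<inter> topspace (proj_lim X) = {x \<in> topspace (X r). f x \<in> U} \<inter> ?V"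
      using VW \<open>0 < r\<close> unfolding topspace_proj_lim U(1) by blast
    moreover have "openin (X r) {x \<in> topspace (X r). f x \<in> U}"
      using f[OF U(2)] U(3) by (rule openin_continuous_map_preimage)
    then have "openin (proj_lim X) ({x \<in> topspace (X r). f x \<in> U} \<inter> ?V)"
      unfolding proj_lim_def Let_def
      using U(2) by (intro topology_generated_by_Basis) blast
    ultimately show "openin (proj_lim X) (f -` U' \<inter> topspace (proj_lim X))" by simp
  next
    show "f ` topspace (proj_lim X) \<subseteq> \<Union>B"
      unfolding topspace_proj_lim UB using VW by blast
  qed
qed

text \<open>Supplies the competing topologies for \<open>continuous_map_ind_lim\<close>. Linearity
  moves f past sums and scalar multiples, so the vector space operations inherit their continuity
  from T, and preimages of convex neighbourhoods form a convex base.\<close>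

lemma locally_convex_pullback:
  fixes f :: "('i \<Rightarrow> complex) \<Rightarrow> ('j \<Rightarrow> complex)"
  assumes lin: "Vector_Spaces.linear cscale cscale f" and T: "locally_convex T"
    and S: "cfun.subspace S" and fS: "f ` S \<subseteq> topspace T"
  shows "locally_convex (pullback_topology S f T)" (is "locally_convex ?P")
proof -
  interpret Vector_Spaces.linear cscale cscale f by (rule lin)
  have top: "topspace ?P = S"
    using fS by (auto simp: topspace_pullback_topology)
  have fP: "continuous_map ?P T f"
    using continuous_map_pullback[OF continuous_map_id, of S f T] by (simp add: o_def)
  \<comment> \<open>Universal property of the pullback: continuity into \<open>?P\<close> is tested
    after composing with f.\<close>
  have into: "continuous_map Y ?P g"
    if "continuous_map Y T (f \<circ> g)" "g ` topspace Y \<subseteq> S" for Y and g :: "'b \<Rightarrow> _"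
    using continuous_map_pullback'[OF that(1), of S] that(2) by blast
  have "continuous_map (prod_topology ?P ?P) ?P (\<lambda>(x, y). x + y)"
  proof (rule into)
    have "continuous_map (prod_topology ?P ?P) (prod_topology T T) (\<lambda>(x, y). (f x, f y))"
      using fP by (simp add: continuous_map_prod_top)
    then have "continuous_map (prod_topology ?P ?P) T ((\<lambda>(x, y). x + y) \<circ> (\<lambda>(x, y). (f x, f y)))"
      using T unfolding locally_convex_def by (blast intro: continuous_map_compose)
    moreover have "(\<lambda>(x, y). x + y) \<circ> (\<lambda>(x, y). (f x, f y)) = f \<circ> (\<lambda>(x, y). x + y)"
      by (auto simp: add)
    ultimately show "continuous_map (prod_topology ?P ?P) T (f \<circ> (\<lambda>(x, y). x + y))" by simp
  qed (use cfun.subspace_add[OF S] in \<open>auto simp: top\<close>)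
  moreover have "continuous_map (prod_topology euclidean ?P) ?P (\<lambda>(a, x). cscale a x)"
  proof (rule into)
    have "continuous_map (prod_topology euclidean ?P) (prod_topology euclidean T)
        (\<lambda>(a :: complex, x). (a, f x))"
      using fP continuous_map_prod_top[of euclidean ?P euclidean T "\<lambda>a. a" f] by simp
    then have "continuous_map (prod_topology euclidean ?P) T
        ((\<lambda>(a, x). cscale a x) \<circ> (\<lambda>(a, x). (a, f x)))"
      using T unfolding locally_convex_def by (blast intro: continuous_map_compose)
    moreover have "(\<lambda>(a, x). cscale a x) \<circ> (\<lambda>(a, x). (a, f x)) = f \<circ> (\<lambda>(a, x). cscale a x)"
      by (auto simp: scale)
    ultimately show "continuous_map (prod_topology euclidean ?P) T (f \<circ> (\<lambda>(a, x). cscale a x))"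
      by simp
  qed (use cfun.subspace_scale[OF S] in \<open>auto simp: top\<close>)
  moreover have "\<exists>W. openin ?P W \<and> cfun_convex W \<and> x \<in> W \<and> W \<subseteq> U" if U: "openin ?P U" "x \<in> U" for U x
  proof -
    obtain U' where U': "openin T U'" "U = f -` U' \<inter> S"
      using U(1) by (auto simp: openin_pullback_topology)
    then obtain W where W: "openin T W" "cfun_convex W" "f x \<in> W" "W \<subseteq> U'"
      using T U(2) unfolding locally_convex_def by blast
    have "cfun_convex (f -` W \<inter> S)"
      using W(2) cfun.subspace_add[OF S] cfun.subspace_scale[OF S]
      by (auto simp: cfun_convex_def add scale)
    then show ?thesis
      using W U U'(2) by (intro exI[of _ "f -` W \<inter> S"]) (auto simp: openin_pullback_topology)
  qed
  ultimately show ?thesis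
    using S unfolding locally_convex_def top by blast
qed

text \<open>Dual to the projective case: every locally convex topology competing in
  \<open>ind_lim Y\<close> pulls back along f to one competing in \<open>ind_lim X\<close>, so
  preimages of generators are again generators. The competitors live on spans because the unions
  need not be linear.\<close>

lemma continuous_map_ind_lim:
  assumes lin: "Vector_Spaces.linear cscale cscale f"
    and f: "\<And>r. 0 < r \<Longrightarrow> continuous_map (X r) (Y r) f"
  shows "continuous_map (ind_lim X) (ind_lim Y) f"
proof -
  interpret Vector_Spaces.linear cscale cscale f by (rule lin)
  let ?V = "\<Union>r\<in>{0<..}. topspace (X r)" and ?W = "\<Union>r\<in>{0<..}. topspace (Y r)"
  have VW: "f x \<in> ?W" if "x \<in> ?V" for x
    using that f by (fastforce simp: continuous_map_def Pi_iff)
  have span: "f ` cfun.span ?V \<subseteq> cfun.span ?W"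
    unfolding span_image[symmetric] using VW by (intro cfun.span_mono) blast
  define B where "B = {U \<inter> ?W | U T. locally_convex T \<and> topspace T = cfun.span ?W \<and>
      (\<forall>r>0. continuous_map (Y r) T (\<lambda>c. c)) \<and> openin T U}"
  have G: "ind_lim Y = topology_generated_by B"
    unfolding ind_lim_def Let_def B_def ..
  have UB: "\<Union>B = ?W"
    using topspace_ind_lim[of Y] unfolding G by simp
  show ?thesis
    unfolding G
  proof (rule continuous_on_generated_topo)
    fix U' assume "U' \<in> B"
    then obtain U T where U: "U' = U \<inter> ?W" "openin T U"
      and T: "locally_convex T" "topspace T = cfun.span ?W"
        "\<And>r. 0 < r \<Longrightarrow> continuous_map (Y r) T (\<lambda>c. c)"
      unfolding B_def by blast
    \<comment> \<open>P is the competitor on the source side; its admissibility uses the continuity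
      of f from \<open>X r\<close> to \<open>Y r\<close> followed by the inclusion into T.\<close>
    define P where "P = pullback_topology (cfun.span ?V) f T"
    have "locally_convex P"
      unfolding P_def using span T(2)
      by (intro locally_convex_pullback[OF lin T(1) cfun.subspace_span]) simp
    moreover have "topspace P = cfun.span ?V"
      using span T(2) by (auto simp: P_def topspace_pullback_topology)
    moreover have "continuous_map (X r) P (\<lambda>c. c)" if "0 < r" for r
      unfolding P_def
    proof (rule continuous_map_pullback')
      show "continuous_map (X r) T (f \<circ> (\<lambda>c. c))"
        using continuous_map_compose[OF f[OF that] T(3)[OF that]] by (simp add: o_def)
      show "topspace (X r) \<subseteq> (\<lambda>c. c) -` cfun.span ?V"
        using that cfun.span_superset[of ?V] by auto
    qed
    moreover have "openin P (f -` U \<inter> cfun.span ?V)"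
      using U(2) by (auto simp: P_def openin_pullback_topology)
    ultimately have "openin (ind_lim X) (f -` U \<inter> cfun.span ?V \<inter> ?V)"
      unfolding ind_lim_def Let_def by (intro topology_generated_by_Basis) blast
    \<comment> \<open>By \<open>VW\<close> the cut with \<open>?W\<close> costs nothing on
      \<open>?V\<close>, and \<open>?V\<close> lies in its span, so the preimage is exactly the
      generator just obtained.\<close>
    moreover have "f -` U' \<inter> topspace (ind_lim X) = f -` U \<inter> cfun.span ?V \<inter> ?V"
      using VW cfun.span_superset[of ?V] unfolding topspace_ind_lim U(1) by blast
    ultimately show "openin (ind_lim X) (f -` U' \<inter> topspace (ind_lim X))" by simp
  next
    show "f ` topspace (ind_lim X) \<subseteq> \<Union>B"
      unfolding topspace_ind_lim UB using VW by blast
  qed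
qed

section \<open>Reindexing in weighted sequence spaces\<close>

lemma ennreal_powr_mono: "x \<le> y \<Longrightarrow> 0 \<le> a \<Longrightarrow> ennreal_powr x a \<le> ennreal_powr y a"
  by (auto simp: ennreal_powr_def top_unique less_top intro!: ennreal_leI powr_mono2 enn2real_mono)

lemma lp_norm_reindex_le:
  assumes inj: "inj_on h I" and sub: "h ` I \<subseteq> J"
    and eq: "\<And>i. i \<in> I \<Longrightarrow> f i = g (h i)"
  shows "lp_norm p I f \<le> lp_norm p J g"
proof -
  have "(SUP i\<in>I. f i) \<le> (SUP j\<in>J. g j)"
    using sub by (auto simp: eq intro!: SUP_least SUP_upper)
  moreover have "(\<integral>\<^sup>+ i. ennreal_powr (f i) q \<partial>count_space I)
      \<le> (\<integral>\<^sup>+ j. ennreal_powr (g j) q \<partial>count_space J)" for q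
  proof -
    have "(\<integral>\<^sup>+ i. ennreal_powr (f i) q \<partial>count_space I)
        = (\<integral>\<^sup>+ i. ennreal_powr (g (h i)) q \<partial>count_space I)"
      by (rule nn_integral_cong) (simp add: eq)
    also have "\<dots> = (\<integral>\<^sup>+ j. ennreal_powr (g j) q \<partial>count_space (h ` I))"
      by (rule nn_integral_bij_count_space) (rule inj_on_imp_bij_betw[OF inj])
    \<comment> \<open>With indicators both integrals run over the whole type, where the integrands
      compare pointwise.\<close>
    also have "\<dots> \<le> (\<integral>\<^sup>+ j. ennreal_powr (g j) q \<partial>count_space J)"
      using sub by (subst (1 2) nn_integral_count_space_indicator)
        (auto simp: image_subset_iff intro!: nn_integral_mono split: split_indicator)
    finally show ?thesis .
  qed
  ultimately show ?thesis
    by (auto simp: lp_norm_def intro!: ennreal_powr_mono)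
qed

text \<open>Abstract form of the trace map, free of multi-indices. The value 0 off I is what
  membership in \<open>wspace\<close> demands.\<close>

definition reindex :: "'i set \<Rightarrow> ('i \<Rightarrow> 'j) \<Rightarrow> ('j \<Rightarrow> complex) \<Rightarrow> ('i \<Rightarrow> complex)" where
  "reindex I h c = (\<lambda>i. if i \<in> I then c (h i) else 0)"

lemma linear_reindex: "Vector_Spaces.linear cscale cscale (reindex I h)"
  by (unfold_locales) (auto simp: reindex_def cscale_def)

text \<open>The map is additive and does not increase the weighted quasi-seminorm, so it sends each
  ball into the ball of the same radius about the image point.\<close>

lemma continuous_map_reindex:
  assumes inj: "inj_on h I" and sub: "h ` I \<subseteq> J"
    and eq: "\<And>i. i \<in> I \<Longrightarrow> \<omega> i = \<omega>' (h i)"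
  shows "continuous_map (wlp p J \<omega>') (wlp p I \<omega>) (reindex I h)"
proof -
  have norm: "wnorm p I \<omega> (reindex I h c) \<le> wnorm p J \<omega>' c" for c
    unfolding wnorm_def using inj sub
    by (rule lp_norm_reindex_le) (simp add: reindex_def eq)
  have diff: "reindex I h c' - reindex I h c = reindex I h (c' - c)" for c c'
    by (auto simp: reindex_def)
  have maps: "reindex I h c \<in> wspace p I \<omega>" if "c \<in> wspace p J \<omega>'" for c
    using that norm[of c] by (auto simp: wspace_def reindex_def[abs_def] intro: order.strict_trans1)
  have "wopen p J \<omega>' {c \<in> wspace p J \<omega>'. reindex I h c \<in> U}" if U: "wopen p I \<omega> U" for U
    unfolding wopen_def
  proof (intro conjI ballI)
    fix c assume "c \<in> {c \<in> wspace p J \<omega>'. reindex I h c \<in> U}"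
    then obtain e :: real where "0 < e"
      and e: "{c' \<in> wspace p I \<omega>. wnorm p I \<omega> (c' - reindex I h c) < ennreal e} \<subseteq> U"
      using U unfolding wopen_def by blast
    have "reindex I h c' \<in> U" if "c' \<in> wspace p J \<omega>'" "wnorm p J \<omega>' (c' - c) < ennreal e" for c'
      using e maps[OF that(1)] order.strict_trans1[OF norm that(2)] by (auto simp: diff)
    then show "\<exists>\<epsilon>>0::real. {c' \<in> wspace p J \<omega>'. wnorm p J \<omega>' (c' - c) < ennreal \<epsilon>}
        \<subseteq> {c \<in> wspace p J \<omega>'. reindex I h c \<in> U}"
      using \<open>0 < e\<close> by blast
  qed blast
  then show ?thesis
    using maps by (auto simp: continuous_map_def openin_wlp topspace_wlp)
qed

section \<open>The trace map\<close>

lemma inj_on_iota_star: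
  assumes "\<tau> permutes {1..d+n}"
  shows "inj_on (iota_star \<tau> d) (mindices d)"
  by (rule inj_onI, rule ext) (metis iota_star_permuted[OF assms])

text \<open>Summing along \<tau> turns \<open>iota_star\<close> back into \<alpha>, whose entries
  beyond d vanish.\<close>

lemma mlen_iota_star:
  assumes \<tau>: "\<tau> permutes {1..d+n}" and \<alpha>: "\<alpha> \<in> mindices d"
  shows "mlen (d+n) (iota_star \<tau> d \<alpha>) = mlen d \<alpha>"
proof -
  have "mlen (d+n) (iota_star \<tau> d \<alpha>) = (\<Sum>j\<in>{1..d+n}. \<alpha> j)"
    unfolding mlen_def
    by (subst sum.permute[OF \<tau>]) (simp add: iota_star_permuted[OF \<tau> \<alpha>])
  also have "\<dots> = mlen d \<alpha>"
    unfolding mlen_def using \<alpha> by (intro sum.mono_neutral_right) (auto simp: mindices_def)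
  finally show ?thesis .
qed

lemma mfact_iota_star:
  assumes \<tau>: "\<tau> permutes {1..d+n}" and \<alpha>: "\<alpha> \<in> mindices d"
  shows "mfact (d+n) (iota_star \<tau> d \<alpha>) = mfact d \<alpha>"
proof -
  have "mfact (d+n) (iota_star \<tau> d \<alpha>) = (\<Prod>j\<in>{1..d+n}. fact (\<alpha> j))"
    unfolding mfact_def
    by (subst prod.permute[OF \<tau>]) (simp add: iota_star_permuted[OF \<tau> \<alpha>])
  \<comment> \<open>The padded entries are 0 and contribute the factor
    \<open>fact 0 = 1\<close>.\<close>
  also have "\<dots> = mfact d \<alpha>"
    unfolding mfact_def using \<alpha> by (intro prod.mono_neutral_right) (auto simp: mindices_def)
  finally show ?thesis .
qed

text \<open>The same r occurs on both sides, so source and target limits can be compared parameter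
  by parameter.\<close>

lemma theta_iota_star:
  assumes "\<tau> permutes {1..d+n}" "\<alpha> \<in> mindices d"
  shows "theta (d+n) s r (iota_star \<tau> d \<alpha>) = theta d s r \<alpha>"
  by (cases s) (simp_all add: mlen_iota_star[OF assms] mfact_iota_star[OF assms])

lemma trace_map_eq_reindex:
  "trace_map \<tau>2 d2 \<tau>1 d1 =
     reindex (pair_indices d2 d1) (map_prod (iota_star \<tau>2 d2) (iota_star \<tau>1 d1))"
  by (auto simp: fun_eq_iff trace_map_def reindex_def)

lemma linear_trace_map: "Vector_Spaces.linear cscale cscale (trace_map \<tau>2 d2 \<tau>1 d1)"
  unfolding trace_map_eq_reindex by (rule linear_reindex)

text \<open>The weights are left abstract so that one statement serves \<open>vartheta\<close>, its
  reciprocal, \<open>omega\<close> and \<open>omega_star\<close>.\<close>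

lemma continuous_map_trace_map:
  assumes \<tau>1: "\<tau>1 permutes {1..d1+n1}" and \<tau>2: "\<tau>2 permutes {1..d2+n2}"
    and "\<And>\<alpha>2 \<alpha>1. \<alpha>2 \<in> mindices d2 \<Longrightarrow> \<alpha>1 \<in> mindices d1 \<Longrightarrow>
      \<omega> (\<alpha>2, \<alpha>1) = \<omega>' (iota_star \<tau>2 d2 \<alpha>2, iota_star \<tau>1 d1 \<alpha>1)"
  shows "continuous_map (wlp p (pair_indices (d2+n2) (d1+n1)) \<omega>')
    (wlp p (pair_indices d2 d1) \<omega>) (trace_map \<tau>2 d2 \<tau>1 d1)"
  unfolding trace_map_eq_reindex
  using assms(3) iota_star_in_mindices[OF \<tau>1] iota_star_in_mindices[OF \<tau>2]
  by (intro continuous_map_reindex)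
     (auto simp: pair_indices_def intro!: map_prod_inj_on inj_on_iota_star[OF \<tau>1] inj_on_iota_star[OF \<tau>2])

theorem proposition6p3:
  fixes p :: ennreal and s1 s2 :: windex
    and d1 d2 n1 n2 :: nat and \<tau>1 \<tau>2 :: "nat \<Rightarrow> nat"
  assumes "0 < p"
    and "\<tau>1 permutes {1..d1 + n1}"
    and "\<tau>2 permutes {1..d2 + n2}"
  shows
    "(s1 \<in> R_flat_closed \<and> s2 \<in> R_flat_closed \<longrightarrow>
        continuous_map (A_hat p s2 s1 (d2 + n2) (d1 + n1)) (A_hat p s2 s1 d2 d1)
          (trace_map \<tau>2 d2 \<tau>1 d1) \<and>
        continuous_map (A_hat_star p s2 s1 (d2 + n2) (d1 + n1)) (A_hat_star p s2 s1 d2 d1)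
          (trace_map \<tau>2 d2 \<tau>1 d1) \<and>
        continuous_map (B_hat p s2 s1 (d2 + n2) (d1 + n1)) (B_hat p s2 s1 d2 d1)
          (trace_map \<tau>2 d2 \<tau>1 d1) \<and>
        continuous_map (B_hat_star p s2 s1 (d2 + n2) (d1 + n1)) (B_hat_star p s2 s1 d2 d1)
          (trace_map \<tau>2 d2 \<tau>1 d1) \<and>
        continuous_map (C_hat p s2 s1 (d2 + n2) (d1 + n1)) (C_hat p s2 s1 d2 d1)
          (trace_map \<tau>2 d2 \<tau>1 d1) \<and>
        continuous_map (C_hat_star p s2 s1 (d2 + n2) (d1 + n1)) (C_hat_star p s2 s1 d2 d1)
          (trace_map \<tau>2 d2 \<tau>1 d1)) \<and>
     (s1 \<in> R_flat_infty \<and> s2 \<in> R_flat_infty \<longrightarrow>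
        continuous_map (A0_hat p s2 s1 (d2 + n2) (d1 + n1)) (A0_hat p s2 s1 d2 d1)
          (trace_map \<tau>2 d2 \<tau>1 d1) \<and>
        continuous_map (A0_hat_star p s2 s1 (d2 + n2) (d1 + n1)) (A0_hat_star p s2 s1 d2 d1)
          (trace_map \<tau>2 d2 \<tau>1 d1) \<and>
        continuous_map (B0_hat p s2 s1 (d2 + n2) (d1 + n1)) (B0_hat p s2 s1 d2 d1)
          (trace_map \<tau>2 d2 \<tau>1 d1) \<and>
        continuous_map (B0_hat_star p s2 s1 (d2 + n2) (d1 + n1)) (B0_hat_star p s2 s1 d2 d1)
          (trace_map \<tau>2 d2 \<tau>1 d1) \<and>
        continuous_map (C0_hat p s2 s1 (d2 + n2) (d1 + n1)) (C0_hat p s2 s1 d2 d1)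
          (trace_map \<tau>2 d2 \<tau>1 d1) \<and>
        continuous_map (C0_hat_star p s2 s1 (d2 + n2) (d1 + n1)) (C0_hat_star p s2 s1 d2 d1)
          (trace_map \<tau>2 d2 \<tau>1 d1))"
  unfolding A_hat_def A_hat_star_def B_hat_def B_hat_star_def C_hat_def C_hat_star_def
    A0_hat_def A0_hat_star_def B0_hat_def B0_hat_star_def C0_hat_def C0_hat_star_def
  \<comment> \<open>The limits are peeled off from the outside in, whatever their order, with
    \<open>linear_trace_map\<close> meeting the linearity condition at each inductive limit. What
    remains are equalities of weights, which \<open>theta_iota_star\<close> settles in each variable
    separately.\<close>
  by (intro conjI impI continuous_map_ind_lim continuous_map_proj_lim linear_trace_map
      continuous_map_trace_map assms)
     (simp_all add: vartheta_def omega_def omega_star_def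
       theta_iota_star[OF assms(2)] theta_iota_star[OF assms(3)])

end
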